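(* For every frame $L$, the congruence frame $\mathbb{C}L$ is ultraparacompact.
   Context: A (frame) congruence on a frame $L$ is an equivalence relation on $L$ which is a subframe of $L\times L$. The congruence frame $\mathbb{C}L$ is the set of all frame congruences on $L$ ordered by inclusion, which is itself a frame. A cover of a frame is a subset with join $1$. A partition of a frame is a cover consisting of pairwise disjoint nonzero elements ($p\wedge q=0$ for distinct members $p,q$). A frame is ultraparacompact if every cover is refined by a partition, i.e. for every cover $A$ there is a partition $P$ such that each $p\in P$ satisfies $p\le a$ for some $a\in A$. *)

theory Defs
  imports "HOL-Algebra.Complete_Lattice"
begin

locale frame = complete_lattice L for L (structure) +
  assumes meet_Sup_distrib:
    "\<lbrakk>a \<in> carrier L; S \<subseteq> carrier L\<rbrakk> \<Longrightarrow> a \<sqinter> (\<Squnion>S) = \<Squnion>((\<lambda>s. a \<sqinter> s) ` S)"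

definition prod_gorder :: "('a, 'm) gorder_scheme \<Rightarrow> ('b, 'n) gorder_scheme \<Rightarrow> ('a \<times> 'b) gorder" where
  "prod_gorder L M =
    \<lparr>carrier = carrier L \<times> carrier M,
     eq = (=),
     le = (\<lambda>x y. fst x \<sqsubseteq>\<^bsub>L\<^esub> fst y \<and> snd x \<sqsubseteq>\<^bsub>M\<^esub> snd y)\<rparr>"

text \<open>The bottom element needs no separate clause: it is the join of the empty set.\<close>

definition subframe :: "'a set \<Rightarrow> ('a, 'm) gorder_scheme \<Rightarrow> bool" where
  "subframe S L \<longleftrightarrow>
    S \<subseteq> carrier L \<and>
    \<top>\<^bsub>L\<^esub> \<in> S \<and>
    (\<forall>x\<in>S. \<forall>y\<in>S. x \<sqinter>\<^bsub>L\<^esub> y \<in> S) \<and>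
    (\<forall>A. A \<subseteq> S \<longrightarrow> \<Squnion>\<^bsub>L\<^esub>A \<in> S)"

definition frame_congruence :: "('a, 'm) gorder_scheme \<Rightarrow> ('a \<times> 'a) set \<Rightarrow> bool" where
  "frame_congruence L \<theta> \<longleftrightarrow> equiv (carrier L) \<theta> \<and> subframe \<theta> (prod_gorder L L)"

definition congruence_frame :: "('a, 'm) gorder_scheme \<Rightarrow> ('a \<times> 'a) set gorder" where
  "congruence_frame L = \<lparr>carrier = {\<theta>. frame_congruence L \<theta>}, eq = (=), le = (\<subseteq>)\<rparr>"

definition cover :: "('a, 'm) gorder_scheme \<Rightarrow> 'a set \<Rightarrow> bool" where
  "cover L A \<longleftrightarrow> A \<subseteq> carrier L \<and> \<Squnion>\<^bsub>L\<^esub>A = \<top>\<^bsub>L\<^esub>"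

definition frame_partition :: "('a, 'm) gorder_scheme \<Rightarrow> 'a set \<Rightarrow> bool" where
  "frame_partition L P \<longleftrightarrow>
    cover L P \<and> \<bottom>\<^bsub>L\<^esub> \<notin> P \<and> pairwise (\<lambda>p q. p \<sqinter>\<^bsub>L\<^esub> q = \<bottom>\<^bsub>L\<^esub>) P"

definition ultraparacompact :: "('a, 'm) gorder_scheme \<Rightarrow> bool" where
  "ultraparacompact L \<longleftrightarrow>
    frame L \<and>
    (\<forall>A. cover L A \<longrightarrow>
      (\<exists>P. frame_partition L P \<and> (\<forall>p\<in>P. \<exists>a\<in>A. p \<sqsubseteq>\<^bsub>L\<^esub> a)))"

end

theory Submission
  imports Defs
begin

text \<open>
  For \<open>a \<noteq> \<top>\<close> in \<open>L\<close> the congruence of the Booleanization of \<open>\<up>a\<close> is proper, so a cover of the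
  congruence frame has a member \<open>\<theta>\<close> not contained in it. This yields some \<open>b\<close> strictly above \<open>a\<close>
  with \<open>(a, b) \<in> \<theta>\<close>, and then the locally closed congruence \<open>\<nabla>\<^sub>b \<and> \<Delta>\<^sub>a\<close>, which is generated by
  \<open>(a, b)\<close>, lies below \<open>\<theta>\<close>. A maximal family of pairwise disjoint nonzero congruences that refines
  the cover and has a join of the form \<open>\<nabla>\<^sub>c\<close> must therefore have \<open>c = \<top>\<close>: otherwise it could be
  enlarged by \<open>\<nabla>\<^sub>b \<and> \<Delta>\<^sub>c\<close>, which is disjoint from \<open>\<nabla>\<^sub>c\<close> and raises the join to \<open>\<nabla>\<^sub>b\<close>.
\<close>

section \<open>Evaluating lattice operations\<close>

text \<open>Joins, meets, top and bottom are choice terms. In a \<open>partial_order\<close>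
  extremal elements are unique, so exhibiting one determines the chosen value.\<close>

lemma (in partial_order) sup_eqI: "is_lub L s A \<Longrightarrow> \<Squnion>A = s"
  unfolding sup_def by (blast intro: someI2 least_unique)

lemma (in partial_order) inf_eqI: "greatest L i (Lower L A) \<Longrightarrow> \<Sqinter>A = i"
  unfolding inf_def by (blast intro: someI2 greatest_unique)

lemma (in partial_order) bottom_eqI: "least L x (carrier L) \<Longrightarrow> \<bottom> = x"
  unfolding bottom_def by (blast intro: someI2 least_unique)

lemma (in partial_order) top_eqI: "greatest L x (carrier L) \<Longrightarrow> \<top> = x"
  unfolding top_def by (blast intro: someI2 greatest_unique)

section \<open>The product order and congruences in coordinates\<close>

lemma partial_order_prod_gorder:
  assumes "partial_order L" "partial_order M"
  shows "partial_order (prod_gorder L M)"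
proof -
  interpret L: partial_order L by fact
  interpret M: partial_order M by fact
  show ?thesis
    by unfold_locales
      (auto simp: prod_gorder_def prod_eq_iff intro: L.le_trans M.le_trans)
qed

context frame
begin

lemma sup_prod_gorder:
  assumes "A \<subseteq> carrier L \<times> carrier L"
  shows "\<Squnion>\<^bsub>prod_gorder L L\<^esub>A = (\<Squnion>(fst ` A), \<Squnion>(snd ` A))"
proof -
  have sub: "fst ` A \<subseteq> carrier L" "snd ` A \<subseteq> carrier L"
    using assms by force+
  have "is_lub (prod_gorder L L) (\<Squnion>(fst ` A), \<Squnion>(snd ` A)) A"
  proof (rule least_UpperI)
    fix y assume "y \<in> Upper (prod_gorder L L) A"
    then have y: "y \<in> carrier L \<times> carrier L" "\<And>x. x \<in> A \<Longrightarrow> fst x \<sqsubseteq> fst y \<and> snd x \<sqsubseteq> snd y"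
      using assms by (auto simp: prod_gorder_def Upper_def)
    then have "\<Squnion>(fst ` A) \<sqsubseteq> fst y" "\<Squnion>(snd ` A) \<sqsubseteq> snd y"
      using sub by (auto intro!: weak.sup_least)
    then show "(\<Squnion>(fst ` A), \<Squnion>(snd ` A)) \<sqsubseteq>\<^bsub>prod_gorder L L\<^esub> y"
      by (simp add: prod_gorder_def)
  qed (use assms sub in \<open>auto simp: prod_gorder_def intro!: weak.sup_upper\<close>)
  then show ?thesis
    by (rule partial_order.sup_eqI[OF partial_order_prod_gorder[OF partial_order_axioms partial_order_axioms]])
qed

lemma meet_prod_gorder:
  assumes "x \<in> carrier L \<times> carrier L" "y \<in> carrier L \<times> carrier L"
  shows "x \<sqinter>\<^bsub>prod_gorder L L\<^esub> y = (fst x \<sqinter> fst y, snd x \<sqinter> snd y)"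
proof -
  have "greatest (prod_gorder L L) (fst x \<sqinter> fst y, snd x \<sqinter> snd y) (Lower (prod_gorder L L) {x, y})"
    using assms
    by (intro greatest_LowerI)
      (auto simp: prod_gorder_def Lower_def intro!: meet_left meet_right meet_le)
  then show ?thesis
    unfolding meet_def
    by (rule partial_order.inf_eqI[OF partial_order_prod_gorder[OF partial_order_axioms partial_order_axioms]])
qed

lemma top_prod_gorder: "\<top>\<^bsub>prod_gorder L L\<^esub> = (\<top>, \<top>)"
proof -
  have "greatest (prod_gorder L L) (\<top>, \<top>) (carrier (prod_gorder L L))"
    by (auto simp: prod_gorder_def greatest_def)
  then show ?thesis
    by (rule partial_order.top_eqI[OF partial_order_prod_gorder[OF partial_order_axioms partial_order_axioms]])
qed

text \<open>Joins and meets in the product are computed coordinatewise, and the clause for the top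
  element is reflexivity at \<open>\<top>\<close>.\<close>

lemma frame_congruence_iff:
  "frame_congruence L \<theta> \<longleftrightarrow>
    equiv (carrier L) \<theta> \<and>
    (\<forall>x y x' y'. (x, y) \<in> \<theta> \<longrightarrow> (x', y') \<in> \<theta> \<longrightarrow> (x \<sqinter> x', y \<sqinter> y') \<in> \<theta>) \<and>
    (\<forall>A. A \<subseteq> \<theta> \<longrightarrow> (\<Squnion>(fst ` A), \<Squnion>(snd ` A)) \<in> \<theta>)"
proof (cases "equiv (carrier L) \<theta>")
  case True
  then have sub: "\<theta> \<subseteq> carrier L \<times> carrier L"
    by (auto simp: equiv_def)
  have "(\<top>, \<top>) \<in> \<theta>"
    using True by (auto simp: equiv_def refl_on_def)
  moreover have "p \<sqinter>\<^bsub>prod_gorder L L\<^esub> q = (fst p \<sqinter> fst q, snd p \<sqinter> snd q)" if "p \<in> \<theta>" "q \<in> \<theta>" for p q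
    using sub that by (intro meet_prod_gorder) auto
  then have "(\<forall>p\<in>\<theta>. \<forall>q\<in>\<theta>. p \<sqinter>\<^bsub>prod_gorder L L\<^esub> q \<in> \<theta>) \<longleftrightarrow>
      (\<forall>x y x' y'. (x, y) \<in> \<theta> \<longrightarrow> (x', y') \<in> \<theta> \<longrightarrow> (x \<sqinter> x', y \<sqinter> y') \<in> \<theta>)"
    by fastforce
  moreover have "(\<forall>A. A \<subseteq> \<theta> \<longrightarrow> \<Squnion>\<^bsub>prod_gorder L L\<^esub>A \<in> \<theta>) \<longleftrightarrow>
      (\<forall>A. A \<subseteq> \<theta> \<longrightarrow> (\<Squnion>(fst ` A), \<Squnion>(snd ` A)) \<in> \<theta>)"
    using sub by (intro all_cong arg_cong[of _ _ "\<lambda>p. p \<in> \<theta>"] sup_prod_gorder) blast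
  moreover have "\<theta> \<subseteq> carrier (prod_gorder L L)"
    using sub by (simp add: prod_gorder_def)
  ultimately show ?thesis
    using True by (simp add: frame_congruence_def subframe_def top_prod_gorder)
qed (auto simp: frame_congruence_def)

text \<open>Reflexivity settles the empty join, whose two coordinates agree. Restricting to nonempty
  \<open>A\<close> fits \<open>residual\<close>, because \<open>clamp_Sup\<close> concerns nonempty
  families.\<close>

lemma frame_congruenceI:
  assumes "\<theta> \<subseteq> carrier L \<times> carrier L"
    and "\<And>x. x \<in> carrier L \<Longrightarrow> (x, x) \<in> \<theta>"
    and "\<And>x y. (x, y) \<in> \<theta> \<Longrightarrow> (y, x) \<in> \<theta>"
    and "\<And>x y z. \<lbrakk>(x, y) \<in> \<theta>; (y, z) \<in> \<theta>\<rbrakk> \<Longrightarrow> (x, z) \<in> \<theta>"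
    and "\<And>x y x' y'. \<lbrakk>(x, y) \<in> \<theta>; (x', y') \<in> \<theta>\<rbrakk> \<Longrightarrow> (x \<sqinter> x', y \<sqinter> y') \<in> \<theta>"
    and "\<And>A. \<lbrakk>A \<subseteq> \<theta>; A \<noteq> {}\<rbrakk> \<Longrightarrow> (\<Squnion>(fst ` A), \<Squnion>(snd ` A)) \<in> \<theta>"
  shows "frame_congruence L \<theta>"
proof -
  have "(\<Squnion>(fst ` A), \<Squnion>(snd ` A)) \<in> \<theta>" if "A \<subseteq> \<theta>" for A
    using assms(2)[of "\<Squnion>{}"] assms(6)[of A] that by (cases "A = {}") auto
  moreover have "equiv (carrier L) \<theta>"
    using assms(1-4) unfolding equiv_def refl_on_def sym_def trans_def by blast
  ultimately show ?thesis
    using assms(5) by (simp add: frame_congruence_iff)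
qed

lemma
  assumes "frame_congruence L \<theta>"
  shows congruence_subset: "\<theta> \<subseteq> carrier L \<times> carrier L"
    and congruence_refl: "x \<in> carrier L \<Longrightarrow> (x, x) \<in> \<theta>"
    and congruence_sym: "(x, y) \<in> \<theta> \<Longrightarrow> (y, x) \<in> \<theta>"
    and congruence_trans: "\<lbrakk>(x, y) \<in> \<theta>; (y, z) \<in> \<theta>\<rbrakk> \<Longrightarrow> (x, z) \<in> \<theta>"
    and congruence_meet: "\<lbrakk>(x, y) \<in> \<theta>; (x', y') \<in> \<theta>\<rbrakk> \<Longrightarrow> (x \<sqinter> x', y \<sqinter> y') \<in> \<theta>"
    and congruence_Sup: "A \<subseteq> \<theta> \<Longrightarrow> (\<Squnion>(fst ` A), \<Squnion>(snd ` A)) \<in> \<theta>"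
proof -
  have "equiv (carrier L) \<theta>"
    using assms by (simp add: frame_congruence_iff)
  then show "\<theta> \<subseteq> carrier L \<times> carrier L" "x \<in> carrier L \<Longrightarrow> (x, x) \<in> \<theta>"
      "(x, y) \<in> \<theta> \<Longrightarrow> (y, x) \<in> \<theta>" "\<lbrakk>(x, y) \<in> \<theta>; (y, z) \<in> \<theta>\<rbrakk> \<Longrightarrow> (x, z) \<in> \<theta>"
    by (auto simp: equiv_def refl_on_def dest: symD transD)
qed (use assms in \<open>simp_all add: frame_congruence_iff\<close>)

lemma congruence_join:
  assumes "frame_congruence L \<theta>" "(x, y) \<in> \<theta>" "(x', y') \<in> \<theta>"
  shows "(x \<squnion> x', y \<squnion> y') \<in> \<theta>"
  using congruence_Sup[OF assms(1), of "{(x, y), (x', y')}"] assms by (simp add: join_def)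

section \<open>Distributive lattice identities\<close>

lemma meet_join_distrib:
  assumes "a \<in> carrier L" "b \<in> carrier L" "c \<in> carrier L"
  shows "a \<sqinter> (b \<squnion> c) = (a \<sqinter> b) \<squnion> (a \<sqinter> c)"
  using meet_Sup_distrib[of a "{b, c}"] assms by (simp add: join_def)

lemma
  assumes "a \<in> carrier L" "b \<in> carrier L"
  shows join_absorb: "a \<squnion> (a \<sqinter> b) = a" "(b \<sqinter> a) \<squnion> a = a" "(a \<sqinter> b) \<squnion> a = a"
    and meet_absorb: "a \<sqinter> (a \<squnion> b) = a" "(b \<squnion> a) \<sqinter> a = a" "(a \<squnion> b) \<sqinter> a = a"
proof -
  show "(a \<sqinter> b) \<squnion> a = a"
    using assms by (simp add: le_iff_meet[symmetric] meet_left)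
  then show "a \<squnion> (a \<sqinter> b) = a" "(b \<sqinter> a) \<squnion> a = a"
    by (simp_all add: join_comm meet_comm)
  show "a \<sqinter> (a \<squnion> b) = a"
    using assms by (metis le_iff_join join_closed join_left)
  then show "(b \<squnion> a) \<sqinter> a = a" "(a \<squnion> b) \<sqinter> a = a"
    by (simp_all add: join_comm meet_comm)
qed

lemma join_meet_distrib:
  assumes "a \<in> carrier L" "b \<in> carrier L" "c \<in> carrier L"
  shows "a \<squnion> (b \<sqinter> c) = (a \<squnion> b) \<sqinter> (a \<squnion> c)"
proof -
  have "(a \<squnion> b) \<sqinter> (a \<squnion> c) = ((a \<squnion> b) \<sqinter> a) \<squnion> ((a \<squnion> b) \<sqinter> c)"
    using assms by (simp add: meet_join_distrib)
  also have "\<dots> = a \<squnion> (c \<sqinter> (a \<squnion> b))"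
    using assms by (simp add: meet_absorb meet_comm[of L _ c])
  also have "\<dots> = a \<squnion> ((c \<sqinter> a) \<squnion> (c \<sqinter> b))"
    using assms by (simp add: meet_join_distrib)
  also have "\<dots> = (a \<squnion> (a \<sqinter> c)) \<squnion> (b \<sqinter> c)"
    using assms by (simp add: join_assoc meet_comm[of L c])
  also have "\<dots> = a \<squnion> (b \<sqinter> c)"
    using assms by (simp add: join_absorb)
  finally show ?thesis ..
qed

text \<open>Cancellation in a distributive lattice: expanding
  \<open>x \<sqinter> (y \<squnion> a)\<close> gives an expression that is symmetric in
  \<open>x\<close> and \<open>y\<close> under the hypotheses. It will make open and closed
  congruences of the same element disjoint.\<close>

lemma eq_if_meet_join_eq:
  assumes "x \<in> carrier L" "y \<in> carrier L" "a \<in> carrier L" "x \<sqinter> a = y \<sqinter> a" "x \<squnion> a = y \<squnion> a"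
  shows "x = y"
proof -
  have "x = x \<sqinter> (y \<squnion> a)"
    using assms by (metis meet_absorb(1))
  also have "\<dots> = (x \<sqinter> y) \<squnion> (x \<sqinter> a)"
    using assms by (simp add: meet_join_distrib)
  also have "\<dots> = (y \<sqinter> x) \<squnion> (y \<sqinter> a)"
    using assms by (simp add: meet_comm)
  also have "\<dots> = y \<sqinter> (x \<squnion> a)"
    using assms(1-3) by (simp add: meet_join_distrib)
  also have "\<dots> = y"
    using assms by (metis meet_absorb(1))
  finally show ?thesis .
qed

section \<open>Retractions onto intervals\<close>

text \<open>For \<open>u \<sqsubseteq> v\<close> this is the retraction of \<open>L\<close> onto the
  interval from \<open>u\<close> to \<open>v\<close>.\<close>

definition clamp :: "'a \<Rightarrow> 'a \<Rightarrow> 'a \<Rightarrow> 'a" where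
  "clamp u v x = u \<squnion> (v \<sqinter> x)"

lemma clamp_closed [simp]:
  "\<lbrakk>u \<in> carrier L; v \<in> carrier L; x \<in> carrier L\<rbrakk> \<Longrightarrow> clamp u v x \<in> carrier L"
  by (simp add: clamp_def)

text \<open>Meeting with \<open>v\<close> preserves binary meets by idempotence, and joining with
  \<open>u\<close> does so by the dual distributive law.\<close>

lemma clamp_meet:
  assumes "u \<in> carrier L" "v \<in> carrier L" "x \<in> carrier L" "y \<in> carrier L"
  shows "clamp u v (x \<sqinter> y) = clamp u v x \<sqinter> clamp u v y"
proof -
  have "(v \<sqinter> x) \<sqinter> (v \<sqinter> y) = ((v \<sqinter> x) \<sqinter> v) \<sqinter> y"
    using assms by (simp add: meet_assoc)
  also have "(v \<sqinter> x) \<sqinter> v = v \<sqinter> x"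
    using assms by (metis le_iff_join meet_closed meet_left)
  also have "(v \<sqinter> x) \<sqinter> y = v \<sqinter> (x \<sqinter> y)"
    using assms by (simp add: meet_assoc)
  finally have "clamp u v (x \<sqinter> y) = u \<squnion> ((v \<sqinter> x) \<sqinter> (v \<sqinter> y))"
    by (simp add: clamp_def)
  also have "\<dots> = clamp u v x \<sqinter> clamp u v y"
    unfolding clamp_def using assms by (intro join_meet_distrib) auto
  finally show ?thesis .
qed

text \<open>The frame law handles \<open>v\<close>, and a single member of \<open>A\<close> suffices
  to put \<open>u\<close> below the join of the images. The empty family is excluded because
  \<open>clamp u v \<bottom>\<close> is \<open>u\<close>.\<close>

lemma clamp_Sup:
  assumes "u \<in> carrier L" "v \<in> carrier L" "A \<subseteq> carrier L" "A \<noteq> {}"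
  shows "clamp u v (\<Squnion>A) = \<Squnion>(clamp u v ` A)"
proof -
  have sub: "(\<sqinter>) v ` A \<subseteq> carrier L" "clamp u v ` A \<subseteq> carrier L"
    using assms by auto
  have "u \<squnion> \<Squnion>((\<sqinter>) v ` A) = \<Squnion>(clamp u v ` A)"
  proof (rule le_antisym)
    obtain a where a: "a \<in> A" using assms by blast
    have "u \<sqsubseteq> clamp u v a"
      using assms a by (auto simp: clamp_def intro!: join_left)
    also have "clamp u v a \<sqsubseteq> \<Squnion>(clamp u v ` A)"
      using sub a by (auto intro: weak.sup_upper)
    finally have u: "u \<sqsubseteq> \<Squnion>(clamp u v ` A)"
      using assms a sub by auto
    have "v \<sqinter> x \<sqsubseteq> \<Squnion>(clamp u v ` A)" if "x \<in> A" for x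
    proof -
      have "v \<sqinter> x \<sqsubseteq> clamp u v x"
        using assms that by (auto simp: clamp_def intro!: join_right)
      also have "clamp u v x \<sqsubseteq> \<Squnion>(clamp u v ` A)"
        using sub that by (auto intro: weak.sup_upper)
      finally show ?thesis
        using assms that sub by auto
    qed
    then show "u \<squnion> \<Squnion>((\<sqinter>) v ` A) \<sqsubseteq> \<Squnion>(clamp u v ` A)"
      using u assms(1) sub by (auto intro!: join_le weak.sup_least)
  next
    have "clamp u v x \<sqsubseteq> u \<squnion> \<Squnion>((\<sqinter>) v ` A)" if x: "x \<in> A" for x
    proof -
      have "v \<sqinter> x \<sqsubseteq> \<Squnion>((\<sqinter>) v ` A)"
        using sub x by (auto intro: weak.sup_upper)
      also have "\<Squnion>((\<sqinter>) v ` A) \<sqsubseteq> u \<squnion> \<Squnion>((\<sqinter>) v ` A)"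
        using assms sub by (auto intro: join_right)
      finally have "v \<sqinter> x \<sqsubseteq> u \<squnion> \<Squnion>((\<sqinter>) v ` A)"
        using assms x sub by auto
      then show ?thesis
        using assms x sub by (auto simp: clamp_def intro!: join_le join_left)
    qed
    then show "\<Squnion>(clamp u v ` A) \<sqsubseteq> u \<squnion> \<Squnion>((\<sqinter>) v ` A)"
      using assms(1) sub by (auto intro!: weak.sup_least)
  qed (use assms sub in auto)
  then show ?thesis
    using assms by (simp add: clamp_def meet_Sup_distrib)
qed

section \<open>Least and greatest congruence, intersections\<close>

lemma congruence_Id_on: "frame_congruence L (Id_on (carrier L))"
proof (rule frame_congruenceI)
  fix A assume A: "A \<subseteq> Id_on (carrier L)"
  then have "fst p = snd p \<and> snd p \<in> carrier L" if "p \<in> A" for p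
    using that by (auto simp: Id_on_def)
  then have "fst ` A = snd ` A" "snd ` A \<subseteq> carrier L"
    by (auto intro: image_cong)
  then show "(\<Squnion>(fst ` A), \<Squnion>(snd ` A)) \<in> Id_on (carrier L)"
    by auto
qed auto

lemma congruence_UNIV: "frame_congruence L (carrier L \<times> carrier L)"
  by (rule frame_congruenceI) (auto simp: image_subset_iff intro!: weak.sup_closed)

lemma congruence_Inter:
  assumes "S \<noteq> {}" "\<And>\<theta>. \<theta> \<in> S \<Longrightarrow> frame_congruence L \<theta>"
  shows "frame_congruence L (\<Inter>S)"
proof (rule frame_congruenceI)
  show "\<Inter>S \<subseteq> carrier L \<times> carrier L"
    using assms congruence_subset by blast
  fix x y z assume "(x, y) \<in> \<Inter>S" "(y, z) \<in> \<Inter>S"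
  then show "(x, z) \<in> \<Inter>S"
    using assms(2) congruence_trans[of _ x y z] by simp
next
  fix x y x' y' assume "(x, y) \<in> \<Inter>S" "(x', y') \<in> \<Inter>S"
  then show "(x \<sqinter> x', y \<sqinter> y') \<in> \<Inter>S"
    using assms(2) by (simp add: congruence_meet)
next
  fix A assume "A \<subseteq> \<Inter>S"
  then show "(\<Squnion>(fst ` A), \<Squnion>(snd ` A)) \<in> \<Inter>S"
    using assms(2) by (simp add: congruence_Sup le_Inf_iff)
qed (use assms(2) congruence_refl congruence_sym in auto)

lemma congruence_Int:
  "\<lbrakk>frame_congruence L \<theta>; frame_congruence L \<phi>\<rbrakk> \<Longrightarrow> frame_congruence L (\<theta> \<inter> \<phi>)"
  using congruence_Inter[of "{\<theta>, \<phi>}"] by auto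

section \<open>Residuals and the Heyting adjunction\<close>

text \<open>
  With a congruence as first argument this is the Heyting implication of the congruence frame;
  arbitrary sets are allowed so that locally closed congruences become another instance.
\<close>

definition residual :: "('a \<times> 'a) set \<Rightarrow> ('a \<times> 'a) set \<Rightarrow> ('a \<times> 'a) set" where
  "residual T \<psi> = {(x, y). x \<in> carrier L \<and> y \<in> carrier L \<and>
    (\<forall>(u, v)\<in>T. (clamp u v x, clamp u v y) \<in> \<psi>)}"

text \<open>Each pair \<open>(u, v)\<close> contributes the preimage of \<open>\<psi>\<close> under
  \<open>clamp u v\<close>, a map that preserves binary meets and nonempty joins.\<close>

lemma congruence_residual:
  assumes T: "T \<subseteq> carrier L \<times> carrier L" and \<psi>: "frame_congruence L \<psi>"
  shows "frame_congruence L (residual T \<psi>)"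
proof (rule frame_congruenceI)
  fix A assume A: "A \<subseteq> residual T \<psi>" "A \<noteq> {}"
  then have sub: "fst ` A \<subseteq> carrier L" "snd ` A \<subseteq> carrier L"
    by (force simp: residual_def)+
  have "(clamp u v (\<Squnion>(fst ` A)), clamp u v (\<Squnion>(snd ` A))) \<in> \<psi>" if uv: "(u, v) \<in> T" for u v
  proof -
    have "map_prod (clamp u v) (clamp u v) ` A \<subseteq> \<psi>"
      using A uv by (force simp: residual_def)
    from congruence_Sup[OF \<psi> this] show ?thesis
      using sub A(2) uv T by (subst (1 2) clamp_Sup) (auto simp: image_image)
  qed
  then show "(\<Squnion>(fst ` A), \<Squnion>(snd ` A)) \<in> residual T \<psi>"
    using sub by (auto simp: residual_def)
next
  fix x y x' y' assume "(x, y) \<in> residual T \<psi>" "(x', y') \<in> residual T \<psi>"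
  then show "(x \<sqinter> x', y \<sqinter> y') \<in> residual T \<psi>"
    using T by (fastforce simp: residual_def clamp_meet intro: congruence_meet[OF \<psi>])
next
  fix x assume "x \<in> carrier L"
  then show "(x, x) \<in> residual T \<psi>"
    using T by (auto simp: residual_def intro!: congruence_refl[OF \<psi>] clamp_closed)
next
  fix x y z assume "(x, y) \<in> residual T \<psi>" "(y, z) \<in> residual T \<psi>"
  then show "(x, z) \<in> residual T \<psi>"
    unfolding residual_def by (blast intro: congruence_trans[OF \<psi>])
qed (auto simp: residual_def intro: congruence_sym[OF \<psi>])

text \<open>Test the residual on the interval from \<open>x \<sqinter> y\<close> to
  \<open>x \<squnion> y\<close>. Its ends are related by \<open>\<theta>\<close> because
  \<open>x\<close> and \<open>y\<close> are, and clamping to it fixes both \<open>x\<close> and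
  \<open>y\<close>.\<close>

lemma Int_residual_subset:
  assumes "frame_congruence L \<theta>" "frame_congruence L \<psi>"
  shows "\<theta> \<inter> residual \<theta> \<psi> \<subseteq> \<psi>"
proof clarify
  fix x y assume xy: "(x, y) \<in> \<theta>" "(x, y) \<in> residual \<theta> \<psi>"
  then have c: "x \<in> carrier L" "y \<in> carrier L"
    by (auto simp: residual_def)
  have idem: "y \<sqinter> y = y" "y \<squnion> y = y"
    using c by (metis le_iff_join le_refl, metis le_iff_meet le_refl)
  have "(x \<sqinter> y, y) \<in> \<theta>" "(y, x \<squnion> y) \<in> \<theta>"
    using congruence_meet[OF assms(1) xy(1), of y y] congruence_join[OF assms(1) xy(1), of y y]
      congruence_refl[OF assms(1) c(2)] congruence_sym[OF assms(1)]
    by (auto simp: idem)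
  then have "(x \<sqinter> y, x \<squnion> y) \<in> \<theta>"
    by (rule congruence_trans[OF assms(1)])
  then have "(clamp (x \<sqinter> y) (x \<squnion> y) x, clamp (x \<sqinter> y) (x \<squnion> y) y) \<in> \<psi>"
    using xy by (auto simp: residual_def)
  moreover have "clamp (x \<sqinter> y) (x \<squnion> y) x = x" "clamp (x \<sqinter> y) (x \<squnion> y) y = y"
    using c by (simp_all add: clamp_def meet_absorb join_absorb)
  ultimately show "(x, y) \<in> \<psi>"
    by simp
qed

text \<open>Clamping uses only meets and joins with fixed elements, so it preserves
  \<open>\<phi>\<close>. If \<open>(u, v)\<close> is in \<open>\<theta>\<close>, replacing
  \<open>v\<close> by \<open>u\<close> shows that every clamped element is related by
  \<open>\<theta>\<close> to \<open>u\<close>, so any two of them are related.\<close>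

lemma subset_residual:
  assumes "frame_congruence L \<theta>" "frame_congruence L \<phi>" "\<theta> \<inter> \<phi> \<subseteq> \<psi>"
  shows "\<phi> \<subseteq> residual \<theta> \<psi>"
proof clarify
  fix x y assume xy: "(x, y) \<in> \<phi>"
  then have c: "x \<in> carrier L" "y \<in> carrier L"
    using congruence_subset assms(2) by blast+
  have "(clamp u v x, clamp u v y) \<in> \<theta> \<inter> \<phi>" if uv: "(u, v) \<in> \<theta>" for u v
  proof
    have uvc: "u \<in> carrier L" "v \<in> carrier L"
      using uv congruence_subset assms(1) by blast+
    show "(clamp u v x, clamp u v y) \<in> \<phi>"
      unfolding clamp_def
      by (intro congruence_join[OF assms(2)] congruence_meet[OF assms(2)] congruence_refl[OF assms(2)] uvc xy)
    have "(u, clamp u v z) \<in> \<theta>" if "z \<in> carrier L" for z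
    proof -
      have "(u \<squnion> (u \<sqinter> z), u \<squnion> (v \<sqinter> z)) \<in> \<theta>"
        by (intro congruence_join[OF assms(1)] congruence_meet[OF assms(1)] congruence_refl[OF assms(1)]
            uv uvc that)
      then show ?thesis
        using uvc that by (simp add: clamp_def join_absorb)
    qed
    from this[OF c(1)] this[OF c(2)] show "(clamp u v x, clamp u v y) \<in> \<theta>"
      by (blast intro: congruence_trans[OF assms(1) congruence_sym[OF assms(1)]])
  qed
  then show "(x, y) \<in> residual \<theta> \<psi>"
    using c assms(3) by (simp add: residual_def split_beta subset_iff)
qed

section \<open>Locally closed congruences\<close>

text \<open>The congruence \<open>\<Delta>\<^sub>a \<and> \<nabla>\<^sub>b\<close>; in particular \<open>locally_closed \<bottom> c\<close> is \<open>\<nabla>\<^sub>c\<close>.\<close>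

definition locally_closed :: "'a \<Rightarrow> 'a \<Rightarrow> ('a \<times> 'a) set" where
  "locally_closed a b = residual {(\<bottom>, a), (b, \<top>)} (Id_on (carrier L))"

lemma congruence_locally_closed:
  "\<lbrakk>a \<in> carrier L; b \<in> carrier L\<rbrakk> \<Longrightarrow> frame_congruence L (locally_closed a b)"
  unfolding locally_closed_def by (rule congruence_residual) (auto intro: congruence_Id_on)

text \<open>Clamping with \<open>(\<bottom>, a)\<close> is meeting with \<open>a\<close>, and
  clamping with \<open>(b, \<top>)\<close> is joining with \<open>b\<close>; the residual of the
  identity intersects the kernels of these two maps.\<close>

lemma mem_locally_closed_iff:
  assumes "a \<in> carrier L" "b \<in> carrier L"
  shows "(x, y) \<in> locally_closed a b \<longleftrightarrow>
    x \<in> carrier L \<and> y \<in> carrier L \<and> x \<sqinter> a = y \<sqinter> a \<and> x \<squnion> b = y \<squnion> b"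
proof -
  have "clamp \<bottom> a z = z \<sqinter> a" "clamp b \<top> z = z \<squnion> b" if "z \<in> carrier L" for z
    using assms that weak.bottom_join[of "a \<sqinter> z"] weak.top_meet[of z]
    by (simp_all add: clamp_def eq_is_equal join_comm meet_comm)
  then show ?thesis
    using assms by (auto simp: locally_closed_def residual_def Id_on_iff)
qed

text \<open>By symmetry it suffices to relate each of \<open>x\<close>, \<open>y\<close> to their
  meet. Write \<open>z\<close> as \<open>(z \<sqinter> w) \<squnion> (z \<sqinter> b)\<close>;
  modulo \<open>\<theta>\<close> the element \<open>b\<close> may be replaced by \<open>a\<close>,
  and \<open>z \<sqinter> a\<close> is absorbed by \<open>z \<sqinter> w\<close>.\<close>

lemma locally_closed_subset:
  assumes \<theta>: "frame_congruence L \<theta>" and ab: "(a, b) \<in> \<theta>"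
  shows "locally_closed a b \<subseteq> \<theta>"
proof clarify
  fix x y assume "(x, y) \<in> locally_closed a b"
  moreover have c: "a \<in> carrier L" "b \<in> carrier L"
    using ab congruence_subset[OF \<theta>] by auto
  ultimately have xy: "x \<in> carrier L" "y \<in> carrier L" "x \<sqinter> a = y \<sqinter> a" "x \<squnion> b = y \<squnion> b"
    by (auto simp: mem_locally_closed_iff)
  have *: "(z, z \<sqinter> w) \<in> \<theta>"
    if "z \<in> carrier L" "w \<in> carrier L" "z \<sqinter> a = w \<sqinter> a" "z \<squnion> b = w \<squnion> b" for z w
  proof -
    have "z = z \<sqinter> (w \<squnion> b)"
      using that(1) c by (simp add: that(4)[symmetric] meet_absorb)
    also have "\<dots> = (z \<sqinter> w) \<squnion> (z \<sqinter> b)"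
      using that c by (intro meet_join_distrib)
    finally have z: "z = (z \<sqinter> w) \<squnion> (z \<sqinter> b)" .
    have "z \<sqinter> a \<sqsubseteq> z \<sqinter> w"
      using that(1-3) c by (metis meet_closed meet_le meet_left)
    then have "(z \<sqinter> a) \<squnion> (z \<sqinter> w) = z \<sqinter> w"
      using that(1,2) c by (simp add: le_iff_meet)
    moreover have "((z \<sqinter> b) \<squnion> (z \<sqinter> w), (z \<sqinter> a) \<squnion> (z \<sqinter> w)) \<in> \<theta>"
      using that(1,2)
      by (intro congruence_join[OF \<theta>] congruence_meet[OF \<theta>] congruence_refl[OF \<theta>]
          congruence_sym[OF \<theta> ab] meet_closed)
    ultimately have "((z \<sqinter> w) \<squnion> (z \<sqinter> b), z \<sqinter> w) \<in> \<theta>"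
      by (simp add: join_comm[of L "z \<sqinter> b"])
    then show ?thesis
      by (simp flip: z)
  qed
  have "(x, x \<sqinter> y) \<in> \<theta>" "(y, y \<sqinter> x) \<in> \<theta>"
    using * xy by simp_all
  then have "(x, x \<sqinter> y) \<in> \<theta>" "(x \<sqinter> y, y) \<in> \<theta>"
    by (simp_all add: congruence_sym[OF \<theta>] meet_comm[of L y x])
  then show "(x, y) \<in> \<theta>"
    by (rule congruence_trans[OF \<theta>])
qed

section \<open>The congruence of a Booleanization\<close>

text \<open>
  The congruence \<open>(x \<rightarrow> a) = (y \<rightarrow> a)\<close>, that is, the kernel of \<open>L\<close> onto the Booleanization of \<open>\<up>a\<close>.
\<close>

definition boolean_congruence :: "'a \<Rightarrow> ('a \<times> 'a) set" where
  "boolean_congruence a = {(x, y). x \<in> carrier L \<and> y \<in> carrier L \<and>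
    (\<forall>z\<in>carrier L. z \<sqinter> x \<sqsubseteq> a \<longleftrightarrow> z \<sqinter> y \<sqsubseteq> a)}"

text \<open>For meets, the two factors are exchanged one at a time, the other factor being absorbed
  into the test element \<open>z\<close>. For joins, the frame law reduces the test on a join to
  tests on its members.\<close>

lemma congruence_boolean:
  assumes a: "a \<in> carrier L"
  shows "frame_congruence L (boolean_congruence a)"
proof (rule frame_congruenceI)
  fix x y x' y' assume h: "(x, y) \<in> boolean_congruence a" "(x', y') \<in> boolean_congruence a"
  have "z \<sqinter> (x \<sqinter> x') \<sqsubseteq> a \<longleftrightarrow> z \<sqinter> (y \<sqinter> y') \<sqsubseteq> a" if z: "z \<in> carrier L" for z
  proof -
    have cl: "x \<in> carrier L" "y \<in> carrier L" "x' \<in> carrier L" "y' \<in> carrier L"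
      and le_x: "w \<sqinter> x \<sqsubseteq> a \<longleftrightarrow> w \<sqinter> y \<sqsubseteq> a" and le_x': "w \<sqinter> x' \<sqsubseteq> a \<longleftrightarrow> w \<sqinter> y' \<sqsubseteq> a"
      if "w \<in> carrier L" for w
      using h that by (auto simp: boolean_congruence_def)
    have "z \<sqinter> (x \<sqinter> x') \<sqsubseteq> a \<longleftrightarrow> (z \<sqinter> x) \<sqinter> y' \<sqsubseteq> a"
      using z cl[OF z] by (simp add: meet_assoc[symmetric] le_x')
    also have "(z \<sqinter> x) \<sqinter> y' = (z \<sqinter> y') \<sqinter> x"
      using z cl[OF z] by (simp add: meet_assoc meet_comm[of L x])
    also have "(z \<sqinter> y') \<sqinter> x \<sqsubseteq> a \<longleftrightarrow> (z \<sqinter> y') \<sqinter> y \<sqsubseteq> a"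
      using z cl[OF z] by (simp add: le_x)
    also have "(z \<sqinter> y') \<sqinter> y = z \<sqinter> (y \<sqinter> y')"
      using z cl[OF z] by (simp add: meet_assoc meet_comm[of L y])
    finally show ?thesis .
  qed
  then show "(x \<sqinter> x', y \<sqinter> y') \<in> boolean_congruence a"
    using h by (auto simp: boolean_congruence_def)
next
  fix A assume A: "A \<subseteq> boolean_congruence a"
  then have sub: "fst ` A \<subseteq> carrier L" "snd ` A \<subseteq> carrier L"
    by (force simp: boolean_congruence_def)+
  have Sup_le: "z \<sqinter> \<Squnion>B \<sqsubseteq> a \<longleftrightarrow> (\<forall>b\<in>B. z \<sqinter> b \<sqsubseteq> a)" if "z \<in> carrier L" "B \<subseteq> carrier L" for z B
  proof -
    have sub': "(\<sqinter>) z ` B \<subseteq> carrier L"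
      using that by auto
    have "\<Squnion>((\<sqinter>) z ` B) \<sqsubseteq> a \<longleftrightarrow> (\<forall>b\<in>B. z \<sqinter> b \<sqsubseteq> a)"
    proof
      assume le: "\<Squnion>((\<sqinter>) z ` B) \<sqsubseteq> a"
      show "\<forall>b\<in>B. z \<sqinter> b \<sqsubseteq> a"
      proof
        fix b assume "b \<in> B"
        then have "z \<sqinter> b \<sqsubseteq> \<Squnion>((\<sqinter>) z ` B)"
          using sub' by (intro weak.sup_upper) auto
        then show "z \<sqinter> b \<sqsubseteq> a"
          by (rule le_trans[OF _ le]) (use sub' \<open>b \<in> B\<close> a in auto)
      qed
    qed (use sub' a in \<open>auto intro: weak.sup_least\<close>)
    then show ?thesis
      using that by (simp add: meet_Sup_distrib)
  qed
  then show "(\<Squnion>(fst ` A), \<Squnion>(snd ` A)) \<in> boolean_congruence a"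
    using sub A by (auto simp: boolean_congruence_def Sup_le split_beta subset_iff)
qed (auto simp: boolean_congruence_def)

section \<open>The congruence frame is a frame\<close>

lemma carrier_congruence_frame [simp]: "carrier (congruence_frame L) = {\<theta>. frame_congruence L \<theta>}"
  and le_congruence_frame [simp]: "le (congruence_frame L) = (\<subseteq>)"
  by (simp_all add: congruence_frame_def)

lemma complete_lattice_congruence_frame: "complete_lattice (congruence_frame L)"
proof -
  interpret C: partial_order "congruence_frame L"
    by unfold_locales (auto simp: congruence_frame_def)
  show ?thesis
  proof (rule C.complete_latticeI)
    fix S assume S: "S \<subseteq> carrier (congruence_frame L)"
    let ?U = "{\<theta>. frame_congruence L \<theta> \<and> \<Union>S \<subseteq> \<theta>}"
    have "carrier L \<times> carrier L \<in> ?U"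
      using S congruence_UNIV congruence_subset by auto
    then have "frame_congruence L (\<Inter>?U)"
      by (intro congruence_Inter) blast+
    then have "is_lub (congruence_frame L) (\<Inter>?U) S"
      using S by (auto simp: least_def Upper_def Inter_lower)
    then show "\<exists>s. is_lub (congruence_frame L) s S"
      by blast
    \<comment> \<open>Inserting the full congruence keeps the infimum of the empty family inside
      \<open>carrier L \<times> carrier L\<close>.\<close>
    have "frame_congruence L (\<Inter>(insert (carrier L \<times> carrier L) S))"
      using S by (intro congruence_Inter) (auto intro: congruence_UNIV)
    then have "greatest (congruence_frame L) (\<Inter>(insert (carrier L \<times> carrier L) S))
        (Lower (congruence_frame L) S)"
      using S by (auto simp: greatest_def Lower_def dest: subsetD[OF congruence_subset])
    then show "\<exists>i. greatest (congruence_frame L) i (Lower (congruence_frame L) S)"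
      by blast
  qed
qed

lemma meet_congruence_frame:
  assumes "frame_congruence L \<theta>" "frame_congruence L \<phi>"
  shows "\<theta> \<sqinter>\<^bsub>congruence_frame L\<^esub> \<phi> = \<theta> \<inter> \<phi>"
proof -
  interpret C: complete_lattice "congruence_frame L"
    by (rule complete_lattice_congruence_frame)
  have "greatest (congruence_frame L) (\<theta> \<inter> \<phi>) (Lower (congruence_frame L) {\<theta>, \<phi>})"
    using assms congruence_Int by (intro greatest_LowerI) (auto simp: Lower_def)
  then show ?thesis
    unfolding meet_def by (rule C.inf_eqI)
qed

lemma bottom_congruence_frame: "\<bottom>\<^bsub>congruence_frame L\<^esub> = Id_on (carrier L)"
proof -
  interpret C: complete_lattice "congruence_frame L"
    by (rule complete_lattice_congruence_frame)
  show ?thesis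
    by (rule C.bottom_eqI) (auto simp: least_def congruence_Id_on congruence_refl)
qed

lemma top_congruence_frame: "\<top>\<^bsub>congruence_frame L\<^esub> = carrier L \<times> carrier L"
proof -
  interpret C: complete_lattice "congruence_frame L"
    by (rule complete_lattice_congruence_frame)
  show ?thesis
    using congruence_subset
    by (intro C.top_eqI) (auto simp: greatest_def congruence_UNIV)
qed

text \<open>The nontrivial inequality is the Heyting adjunction: every member of \<open>S\<close>
  lies below the residual of \<open>\<theta>\<close> into the join of the meets, hence so does the
  join of \<open>S\<close>, and intersecting with \<open>\<theta>\<close> leads back into that
  join.\<close>

lemma frame_congruence_frame: "frame (congruence_frame L)"
proof -
  interpret C: complete_lattice "congruence_frame L"
    by (rule complete_lattice_congruence_frame)
  show ?thesis
  proof (unfold_locales, rule C.le_antisym)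
    fix \<theta> S assume h: "\<theta> \<in> carrier (congruence_frame L)" "S \<subseteq> carrier (congruence_frame L)"
    let ?meets = "(\<sqinter>\<^bsub>congruence_frame L\<^esub>) \<theta> ` S"
    let ?\<psi> = "\<Squnion>\<^bsub>congruence_frame L\<^esub>?meets"
    have sub: "?meets \<subseteq> carrier (congruence_frame L)"
      using h by (auto simp: meet_congruence_frame intro!: congruence_Int)
    then show closed: "?\<psi> \<in> carrier (congruence_frame L)"
      by (rule C.weak.sup_closed)
    show closed': "\<theta> \<sqinter>\<^bsub>congruence_frame L\<^esub> \<Squnion>\<^bsub>congruence_frame L\<^esub>S \<in> carrier (congruence_frame L)"
      using h by (intro C.meet_closed C.weak.sup_closed)
    have "\<phi> \<subseteq> residual \<theta> ?\<psi>" if "\<phi> \<in> S" for \<phi>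
    proof (rule subset_residual)
      have "\<theta> \<sqinter>\<^bsub>congruence_frame L\<^esub> \<phi> \<subseteq> ?\<psi>"
        using C.weak.sup_upper[OF sub] that by auto
      then show "\<theta> \<inter> \<phi> \<subseteq> ?\<psi>"
        using h that by (subst (asm) meet_congruence_frame) auto
    qed (use h that in auto)
    moreover have "frame_congruence L (residual \<theta> ?\<psi>)"
      using h closed congruence_subset[of \<theta>] by (intro congruence_residual) auto
    ultimately have "\<Squnion>\<^bsub>congruence_frame L\<^esub>S \<subseteq> residual \<theta> ?\<psi>"
      using C.weak.sup_least[OF h(2), of "residual \<theta> ?\<psi>"] by simp
    then show "\<theta> \<sqinter>\<^bsub>congruence_frame L\<^esub> \<Squnion>\<^bsub>congruence_frame L\<^esub>S \<sqsubseteq>\<^bsub>congruence_frame L\<^esub> ?\<psi>"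
      using Int_residual_subset[of \<theta> ?\<psi>] h closed C.weak.sup_closed[OF h(2)]
      by (auto simp: meet_congruence_frame)
    show "?\<psi> \<sqsubseteq>\<^bsub>congruence_frame L\<^esub> \<theta> \<sqinter>\<^bsub>congruence_frame L\<^esub> \<Squnion>\<^bsub>congruence_frame L\<^esub>S"
    proof (rule C.weak.sup_least[OF sub closed'])
      fix \<chi> assume "\<chi> \<in> ?meets"
      then obtain \<phi> where \<phi>: "\<phi> \<in> S" "\<chi> = \<theta> \<inter> \<phi>"
        using h by (auto simp: meet_congruence_frame)
      then show "\<chi> \<sqsubseteq>\<^bsub>congruence_frame L\<^esub> \<theta> \<sqinter>\<^bsub>congruence_frame L\<^esub> \<Squnion>\<^bsub>congruence_frame L\<^esub>S"
        using C.weak.sup_upper[OF h(2) \<phi>(1)] C.weak.sup_closed[OF h(2)] h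
        by (auto simp: meet_congruence_frame)
    qed
  qed
qed

section \<open>Covers of the congruence frame\<close>

text \<open>Joins of congruences are available only as least upper bounds, so covers are tested
  against their upper bounds. This allows a cover to be confronted with one particular proper
  congruence.\<close>

lemma cover_congruence_frame_iff:
  "cover (congruence_frame L) A \<longleftrightarrow>
    (\<forall>\<theta>\<in>A. frame_congruence L \<theta>) \<and>
    (\<forall>\<psi>. frame_congruence L \<psi> \<longrightarrow> \<Union>A \<subseteq> \<psi> \<longrightarrow> \<psi> = carrier L \<times> carrier L)"
proof (cases "\<forall>\<theta>\<in>A. frame_congruence L \<theta>")
  case True
  interpret C: complete_lattice "congruence_frame L"
    by (rule complete_lattice_congruence_frame)
  have sub: "A \<subseteq> carrier (congruence_frame L)"
    using True by auto
  have "\<Union>A \<subseteq> \<psi> \<longleftrightarrow> \<Squnion>\<^bsub>congruence_frame L\<^esub>A \<subseteq> \<psi>" if "frame_congruence L \<psi>" for \<psi>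
    using C.weak.sup_least[OF sub, of \<psi>] C.weak.sup_upper[OF sub] that by auto
  then show ?thesis
    using True C.weak.sup_closed[OF sub] congruence_subset
    by (auto simp: cover_def top_congruence_frame) blast+
qed (auto simp: cover_def)

lemma cover_congruence_frame_step:
  assumes A: "cover (congruence_frame L) A" and a: "a \<in> carrier L" "a \<noteq> \<top>"
  obtains \<theta> b where "\<theta> \<in> A" "(a, b) \<in> \<theta>" "a \<sqsubseteq> b" "a \<noteq> b"
proof -
  have cong: "frame_congruence L \<theta>" if "\<theta> \<in> A" for \<theta>
    using A that by (simp add: cover_congruence_frame_iff)
  \<comment> \<open>The test element \<open>\<top>\<close> separates \<open>\<bottom>\<close> from
    \<open>\<top>\<close>, so the Booleanization congruence is proper.\<close>
  have "\<not> \<top> \<sqsubseteq> a"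
    using a by (auto intro: le_antisym)
  moreover have "\<top> \<sqinter> \<bottom> \<sqsubseteq> a" "\<top> \<sqinter> \<top> = \<top>"
    using a weak.top_meet[of \<bottom>] weak.top_meet[of \<top>] by (simp_all add: eq_is_equal)
  ultimately have "(\<bottom>, \<top>) \<notin> boolean_congruence a"
    unfolding boolean_congruence_def by (auto intro!: bexI[of _ \<top>])
  then have "\<not> \<Union>A \<subseteq> boolean_congruence a"
    using A congruence_boolean[OF a(1)] by (auto simp: cover_congruence_frame_iff)
  then obtain \<theta> x y where \<theta>: "\<theta> \<in> A" "(x, y) \<in> \<theta>" "(x, y) \<notin> boolean_congruence a"
    by auto
  note c = cong[OF \<theta>(1)]
  then obtain z where "z \<in> carrier L" "z \<sqinter> x \<sqsubseteq> a \<longleftrightarrow> \<not> z \<sqinter> y \<sqsubseteq> a"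
    using subsetD[OF congruence_subset[OF c] \<theta>(2)] \<theta>(3) by (auto simp: boolean_congruence_def)
  \<comment> \<open>The pair is swapped if necessary, so that the test holds for the first
    coordinate and fails for the second.\<close>
  then obtain x' y' where z: "z \<in> carrier L" "(x', y') \<in> \<theta>" "z \<sqinter> x' \<sqsubseteq> a" "\<not> z \<sqinter> y' \<sqsubseteq> a"
    using \<theta>(2) congruence_sym[OF c \<theta>(2)] by (cases "z \<sqinter> x \<sqsubseteq> a") auto
  then have cl: "x' \<in> carrier L" "y' \<in> carrier L"
    using congruence_subset[OF c] by auto
  \<comment> \<open>Meeting with \<open>z\<close> and joining with \<open>a\<close> collapses the
    first coordinate to \<open>a\<close> and leaves the second strictly above it; the second is the
    required \<open>b\<close>.\<close>
  have "((z \<sqinter> x') \<squnion> a, (z \<sqinter> y') \<squnion> a) \<in> \<theta>"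
    by (intro congruence_join[OF c] congruence_meet[OF c] congruence_refl[OF c] z a)
  moreover have "(z \<sqinter> x') \<squnion> a = a"
    using z a cl by (simp add: le_iff_meet[symmetric])
  moreover have "a \<sqsubseteq> (z \<sqinter> y') \<squnion> a"
    using z(1) a cl by (simp add: join_right)
  moreover have "a \<noteq> (z \<sqinter> y') \<squnion> a"
    using z(1,4) a cl by (metis join_left meet_closed)
  ultimately show thesis
    using that[OF \<theta>(1), of "(z \<sqinter> y') \<squnion> a"] by simp
qed

section \<open>A partition from a maximal disjoint family\<close>

lemma ultraparacompact_congruence_frame: "ultraparacompact (congruence_frame L)"
  unfolding ultraparacompact_def
proof (intro conjI allI impI frame_congruence_frame)
  fix A assume A: "cover (congruence_frame L) A"
  define exhausts where "exhausts P c \<longleftrightarrow> c \<in> carrier L \<and> \<Union>P \<subseteq> locally_closed \<bottom> c \<and>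
    (\<forall>\<psi>. frame_congruence L \<psi> \<longrightarrow> \<Union>P \<subseteq> \<psi> \<longrightarrow> (\<bottom>, c) \<in> \<psi>)" for P c
  \<comment> \<open>\<open>exhausts P c\<close> says that the join of \<open>P\<close> is \<open>\<nabla>\<^sub>c\<close>, because \<open>(\<bottom>, c)\<close> generates \<open>\<nabla>\<^sub>c\<close>.\<close>
  define partial where "partial = {P.
    (\<forall>p\<in>P. frame_congruence L p \<and> p \<noteq> Id_on (carrier L) \<and> (\<exists>\<theta>\<in>A. p \<subseteq> \<theta>)) \<and>
    pairwise (\<lambda>p q. p \<inter> q = Id_on (carrier L)) P \<and> (\<exists>c. exhausts P c)}"
  have closed_iff: "(x, y) \<in> locally_closed \<bottom> c \<longleftrightarrow> x \<in> carrier L \<and> y \<in> carrier L \<and> x \<squnion> c = y \<squnion> c"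
    if "c \<in> carrier L" for x y c
    using that weak.bottom_meet eq_is_equal meet_comm
    by (metis mem_locally_closed_iff weak.bottom_closed)
  \<comment> \<open>It suffices that the pair \<open>(\<bottom>, c)\<close> lies in the larger
    congruence: joining either coordinate with \<open>d\<close> gives \<open>d\<close>.\<close>
  have closed_mono: "locally_closed \<bottom> c \<subseteq> locally_closed \<bottom> d"
    if "c \<sqsubseteq> d" "c \<in> carrier L" "d \<in> carrier L" for c d
    using that
    by (intro locally_closed_subset congruence_locally_closed)
      (auto simp: closed_iff le_iff_meet intro: weak.bottom_join[unfolded eq_is_equal])
  have "\<exists>M\<in>partial. \<forall>X\<in>partial. M \<subseteq> X \<longrightarrow> X = M"
  proof (rule subset_Zorn')
    fix \<C> assume chain: "subset.chain partial \<C>"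
    \<comment> \<open>Collecting all exhausting elements avoids choosing one for each family. For
      the empty chain this gives the empty family, exhausted by \<open>\<bottom>\<close>.\<close>
    define cs where "cs = {c. \<exists>P\<in>\<C>. exhausts P c}"
    have cs: "cs \<subseteq> carrier L"
      by (auto simp: cs_def exhausts_def)
    have "exhausts (\<Union>\<C>) (\<Squnion>cs)"
      unfolding exhausts_def
    proof (intro conjI allI impI)
      show "\<Squnion>cs \<in> carrier L"
        using cs by (rule weak.sup_closed)
      show "\<Union>(\<Union>\<C>) \<subseteq> locally_closed \<bottom> (\<Squnion>cs)"
      proof (rule Union_least)
        fix p assume "p \<in> \<Union>\<C>"
        then obtain P c where P: "p \<in> P" "P \<in> \<C>" "exhausts P c"
          using chain by (auto simp: subset.chain_def partial_def)
        then have "c \<in> cs"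
          by (auto simp: cs_def)
        then have "locally_closed \<bottom> c \<subseteq> locally_closed \<bottom> (\<Squnion>cs)"
          using cs by (intro closed_mono weak.sup_upper weak.sup_closed) auto
        then show "p \<subseteq> locally_closed \<bottom> (\<Squnion>cs)"
          using P unfolding exhausts_def by blast
      qed
      fix \<psi> assume \<psi>: "frame_congruence L \<psi>" "\<Union>(\<Union>\<C>) \<subseteq> \<psi>"
      then have "Pair \<bottom> ` cs \<subseteq> \<psi>"
        by (auto simp: cs_def exhausts_def) blast
      \<comment> \<open>The pairs \<open>(\<bottom>, c)\<close> are joined inside
        \<open>\<psi>\<close>; the first coordinate remains \<open>\<bottom>\<close>.\<close>
      from congruence_Sup[OF \<psi>(1) this] have "(\<Squnion>((\<lambda>_. \<bottom>) ` cs), \<Squnion>cs) \<in> \<psi>"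
        by (simp add: image_image)
      moreover have "\<Squnion>((\<lambda>_. \<bottom>) ` cs) = \<bottom>"
        by (intro le_antisym weak.sup_least weak.bottom_lower weak.sup_closed) auto
      ultimately show "(\<bottom>, \<Squnion>cs) \<in> \<psi>"
        by simp
    qed
    moreover have "pairwise (\<lambda>p q. p \<inter> q = Id_on (carrier L)) (\<Union>\<C>)"
      using chain by (intro pairwise_chain_Union) (auto simp: subset.chain_def partial_def chain_subset_def)
    ultimately show "\<Union>\<C> \<in> partial"
      using chain by (auto simp: subset.chain_def partial_def)
  qed
  then obtain M where M: "M \<in> partial" and max: "\<And>X. \<lbrakk>X \<in> partial; M \<subseteq> X\<rbrakk> \<Longrightarrow> X = M"
    by blast
  from M obtain c where c: "exhausts M c"
    by (auto simp: partial_def)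
  then have cc: "c \<in> carrier L"
    by (simp add: exhausts_def)
  have "c = \<top>"
  proof (rule ccontr)
    assume "c \<noteq> \<top>"
    then obtain \<theta> b where \<theta>: "\<theta> \<in> A" "(c, b) \<in> \<theta>" "c \<sqsubseteq> b" "c \<noteq> b"
      using cover_congruence_frame_step[OF A cc] by blast
    have \<theta>c: "frame_congruence L \<theta>"
      using A \<theta>(1) by (simp add: cover_congruence_frame_iff)
    then have bc: "b \<in> carrier L"
      using \<theta>(2) congruence_subset by auto
    let ?p = "locally_closed c b"
    have pc: "frame_congruence L ?p"
      using cc bc by (rule congruence_locally_closed)
    have cb: "(c, b) \<in> ?p"
      using \<theta>(3) cc bc by (simp add: mem_locally_closed_iff)
        (metis le_iff_join le_iff_meet le_refl meet_comm)
    have disj: "q \<inter> ?p = Id_on (carrier L)" if "q \<in> M" for q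
    proof
      have "frame_congruence L q"
        using M that by (simp add: partial_def)
      then show "Id_on (carrier L) \<subseteq> q \<inter> ?p"
        using pc by (auto intro: congruence_refl)
      have "q \<subseteq> locally_closed \<bottom> c"
        using c that by (auto simp: exhausts_def)
      \<comment> \<open>A pair in \<open>q\<close> agrees after joining with \<open>c\<close>, a
        pair in \<open>?p\<close> after meeting with \<open>c\<close>; a pair in both has equal
        coordinates by cancellation.\<close>
      then show "q \<inter> ?p \<subseteq> Id_on (carrier L)"
        using cc by (auto simp: closed_iff mem_locally_closed_iff[OF cc bc] Id_on_iff
            intro: eq_if_meet_join_eq dest!: subsetD)
    qed
    \<comment> \<open>Both \<open>\<nabla>\<^sub>c\<close> and \<open>?p\<close> lie below
      \<open>\<nabla>\<^sub>b\<close>; conversely, chaining \<open>(\<bottom>, c)\<close> with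
      \<open>(c, b)\<close> produces the generator \<open>(\<bottom>, b)\<close>.\<close>
    have "exhausts (insert ?p M) b"
      unfolding exhausts_def
    proof (intro conjI allI impI bc)
      have "?p \<subseteq> locally_closed \<bottom> b"
        using bc by (auto simp: closed_iff mem_locally_closed_iff[OF cc bc])
      then show "\<Union>(insert ?p M) \<subseteq> locally_closed \<bottom> b"
        using c closed_mono[OF \<theta>(3) cc bc] by (auto simp: exhausts_def)
      fix \<psi> assume \<psi>: "frame_congruence L \<psi>" "\<Union>(insert ?p M) \<subseteq> \<psi>"
      then have "(\<bottom>, c) \<in> \<psi>" "(c, b) \<in> \<psi>"
        using c cb by (auto simp: exhausts_def)
      then show "(\<bottom>, b) \<in> \<psi>"
        by (rule congruence_trans[OF \<psi>(1)])
    qed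
    moreover have "pairwise (\<lambda>p q. p \<inter> q = Id_on (carrier L)) (insert ?p M)"
      using M disj by (auto simp: pairwise_insert partial_def Int_commute)
    moreover have "?p \<noteq> Id_on (carrier L)"
      using cb \<theta>(4) by (auto simp: Id_on_iff)
    moreover have "?p \<subseteq> \<theta>"
      using \<theta>c \<theta>(2) by (rule locally_closed_subset)
    ultimately have "insert ?p M \<in> partial"
      using M \<theta>(1) pc by (auto simp: partial_def)
    then have "?p \<in> M"
      using max by blast
    \<comment> \<open>As a member of \<open>M\<close>, \<open>?p\<close> would be disjoint from
      itself and so equal to the identity.\<close>
    with disj[of ?p] \<open>?p \<noteq> Id_on (carrier L)\<close> show False
      by simp
  qed
  have "cover (congruence_frame L) M"
    unfolding cover_congruence_frame_iff
  proof (intro conjI allI impI)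
    show "\<forall>p\<in>M. frame_congruence L p"
      using M by (simp add: partial_def)
    fix \<psi> assume \<psi>: "frame_congruence L \<psi>" "\<Union>M \<subseteq> \<psi>"
    then have "(\<bottom>, \<top>) \<in> \<psi>"
      using c \<open>c = \<top>\<close> by (simp add: exhausts_def)
    then have "locally_closed \<bottom> \<top> \<subseteq> \<psi>"
      by (rule locally_closed_subset[OF \<psi>(1)])
    \<comment> \<open>Joining with \<open>\<top>\<close> identifies all elements, so
      \<open>\<nabla>\<close> at \<open>\<top>\<close> is the full congruence.\<close>
    moreover have "locally_closed \<bottom> \<top> = carrier L \<times> carrier L"
      using weak.top_join by (auto simp: closed_iff eq_is_equal join_comm[of _ \<top>])
    ultimately show "\<psi> = carrier L \<times> carrier L"
      using congruence_subset[OF \<psi>(1)] by auto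
  qed
  moreover have "pairwise (\<lambda>p q. p \<sqinter>\<^bsub>congruence_frame L\<^esub> q = \<bottom>\<^bsub>congruence_frame L\<^esub>) M"
    using M by (auto simp: partial_def pairwise_def meet_congruence_frame bottom_congruence_frame)
  ultimately show "\<exists>P. frame_partition (congruence_frame L) P \<and>
      (\<forall>p\<in>P. \<exists>\<theta>\<in>A. p \<sqsubseteq>\<^bsub>congruence_frame L\<^esub> \<theta>)"
    using M by (intro exI[of _ M]) (auto simp: frame_partition_def partial_def bottom_congruence_frame)
qed

end

theorem corollary3p7:
  fixes L :: "('a, 'm) gorder_scheme"
  assumes "frame L"
  shows "ultraparacompact (congruence_frame L)"
  using assms by (rule frame.ultraparacompact_congruence_frame)

end
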